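(* Let $\Xi$ be a finite set with $|\Xi|=N$, let $\mathcal{F}:\Xi\times\mathbb{R}^K\to\mathbb{R}$ be a forward map such that for each $\xi\in\Xi$ the map $p\mapsto\mathcal{F}(\xi,p)$ is differentiable at a given parameter $p_\ast\in\mathbb{R}^K$, and let $\Gamma\in\mathbb{R}^{N\times N}$ (indexed by $\Xi$) be a symmetric positive definite covariance matrix. Let $G\in\mathbb{R}^{N\times K}$ be the matrix with rows $G_{\xi,:}=(\nabla_p\mathcal{F}(\xi,p_\ast))^\top$, $\xi\in\Xi$, and assume that the Fisher information matrix $\mathcal{I}(\Xi)=G^\top\Gamma^{-1}G\in\mathbb{R}^{K\times K}$ has full rank. For $\xi,\theta\in\Xi$ set $$Y_{\xi,\theta}:=G_{\xi,:}^\top\,\Gamma^{-1}_{\xi,\theta}\,G_{\theta,:}+G_{\theta,:}^\top\,\Gamma^{-1}_{\theta,\xi}\,G_{\xi,:},\qquad \tilde\pi(\xi,\theta):=\frac{\|Y_{\xi,\theta}\|_F}{\sum_{\xi',\theta'\in\Xi}\|Y_{\xi',\theta'}\|_F}.$$ Let $\pi$ be a probability distribution on $\Xi\times\Xi$ satisfying $\pi(\xi,\theta)\ge\beta\,\tilde\pi(\xi,\theta)$ for all $\xi,\theta\in\Xi$, for some $\beta\in(0,1]$. Let $(\xi_1,\theta_1),\dots,(\xi_c,\theta_c)$ be i.i.d. with distribution $\pi$, and define the down-sampled, re-weighted Fisher information matrix $$\tilde{\mathcal{I}}(\Xi_c):=\sum_{j=1}^c\frac{1}{2c\,\pi(\xi_j,\theta_j)}\,Y_{\xi_j,\theta_j}.$$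 Let $\lambda_{\min}^\Xi$ and $\lambda_{\min}^c$ be the smallest eigenvalues, and $c_{\mathrm{inv}}^\Xi$ and $c_{\mathrm{inv}}^c$ the inverse condition numbers, of $\mathcal{I}(\Xi)$ and $\tilde{\mathcal{I}}(\Xi_c)$, respectively. Then for every $\delta\in(0,1)$ and every $\varepsilon\in(0,\lambda_{\min}^\Xi)$, if the integer sample size $c\ge1$ satisfies $$c\ \ge\ \Bigl(\sum_{\xi,\theta\in\Xi}\|Y_{\xi,\theta}\|_F\Bigr)^2\,\frac{\bigl(1+\sqrt{2\beta^{-1}\log(\delta^{-1})}\bigr)^2}{\beta\,\varepsilon^2},$$ then with probability at least $1-\delta$ (over the draw of the samples), $$\lambda_{\min}^c\ \ge\ \lambda_{\min}^\Xi-\varepsilon>0\qquad\text{and}\qquad c_{\mathrm{inv}}^c\ \ge\ c_{\mathrm{inv}}^\Xi\,\frac{\lambda_{\min}^\Xi-\varepsilon}{\lambda_{\min}^\Xi+\varepsilon}.$$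
   Context: $\Xi$ is the design space (set of possible experiments), $K$ the parameter dimension, and the data model is $y(\xi)=\mathcal{F}(\xi,p)+\eta(\xi)$ with $\eta\sim\mathcal{N}(0,\Gamma)$. $\Gamma^{-1}_{\xi,\theta}$ denotes the $(\xi,\theta)$ entry of the inverse matrix $\Gamma^{-1}$. $G_{\xi,:}$ is a $1\times K$ row vector, so $Y_{\xi,\theta}$ is a symmetric $K\times K$ matrix. $\|\cdot\|_F$ is the Frobenius norm and $\log$ the natural logarithm. The inverse condition number of a symmetric matrix is $\lambda_{\min}/\lambda_{\max}$, the ratio of its smallest to its largest eigenvalue. Equivalently, $\tilde{\mathcal{I}}(\Xi_c)=G_c^\top PG_c$, where $G_c\in\mathbb{R}^{2c\times K}$ has rows $G_{\xi_1,:},\dots,G_{\xi_c,:},G_{\theta_1,:},\dots,G_{\theta_c,:}$ and $P\in\mathbb{R}^{2c\times 2c}$ has entries $P_{j,j+c}=P_{j+c,j}=\Gamma^{-1}_{\xi_j,\theta_j}/(2c\,\pi(\xi_j,\theta_j))$ for $j=1,\dots,c$ and zeros elsewhere. *)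

theory Defs
  imports "HOL-Probability.Probability"
begin

definition gradient :: "(real^'k \<Rightarrow> real) \<Rightarrow> real^'k \<Rightarrow> real^'k" where
  "gradient f x = (THE D. GDERIV f x :> D)"

lemma gradient_eqI:
  fixes f :: "real^'k \<Rightarrow> real"
  assumes "GDERIV f x :> D"
  shows "gradient f x = D"
  unfolding gradient_def
proof (rule the_equality)
  show "GDERIV f x :> D" by fact
next
  fix E assume "GDERIV f x :> E"
  then have "(f has_derivative (\<lambda>h. h \<bullet> E)) (at x)"
    by (simp only: gderiv_def)
  moreover have "(f has_derivative (\<lambda>h. h \<bullet> D)) (at x)"
    using assms by (simp only: gderiv_def)
  ultimately have eq: "(\<lambda>h. h \<bullet> E) = (\<lambda>h. h \<bullet> D)"
    by (rule has_derivative_unique)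
  have "(E - D) \<bullet> (E - D) = 0"
    using fun_cong[OF eq, of "E - D"] by (simp only: inner_diff_right diff_self)
  then show "E = D"
    by (simp only: inner_eq_zero_iff right_minus_eq)
qed

lemma gderiv_gradient:
  fixes f :: "real^'k \<Rightarrow> real"
  assumes "f differentiable (at x)"
  shows "GDERIV f x :> gradient f x"
proof -
  obtain f' where f': "(f has_derivative f') (at x)"
    using assms by (auto simp: differentiable_def)
  then have lin: "linear f'"
    by (rule has_derivative_linear)
  define D where "D = adjoint f' 1"
  have "f' h = h \<bullet> D" for h
    using adjoint_works[OF lin, of h 1] by (simp add: D_def)
  then have eq: "f' = (\<lambda>h. h \<bullet> D)"
    by (rule ext)
  have D: "GDERIV f x :> D"
    using f' unfolding eq gderiv_def .
  show ?thesis
    using D unfolding gradient_eqI[OF D] .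
qed

definition symmetric_matrix :: "real^'n^'n \<Rightarrow> bool" where
  "symmetric_matrix A \<longleftrightarrow> transpose A = A"

definition sym_pos_def :: "real^'n^'n \<Rightarrow> bool" where
  "sym_pos_def A \<longleftrightarrow> symmetric_matrix A \<and> (\<forall>x. x \<noteq> 0 \<longrightarrow> x \<bullet> (A *v x) > 0)"

definition frobenius_norm :: "real^'n^'m \<Rightarrow> real" where
  "frobenius_norm A = sqrt (\<Sum>i\<in>UNIV. \<Sum>j\<in>UNIV. (A $ i $ j)\<^sup>2)"

lemma frobenius_norm_eq_norm: "frobenius_norm A = norm A"
  unfolding frobenius_norm_def norm_vec_def L2_set_def real_norm_def power2_abs
  by (simp only: real_sqrt_pow2 sum_nonneg zero_le_power2)

(* For column vectors u and v this is the matrix u v^T; below it is applied to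
   (transposed) rows of G, which are plain vectors here. *)
definition outer :: "real^'n \<Rightarrow> real^'m \<Rightarrow> real^'m^'n" where
  "outer u v = (\<chi> i j. u $ i * v $ j)"

definition eigenvalues :: "real^'n^'n \<Rightarrow> real set" where
  "eigenvalues A = {l. \<exists>v. v \<noteq> 0 \<and> A *v v = l *\<^sub>R v}"

(* Only real eigenvalues are considered, so the following three notions are meant for
   symmetric matrices, whose set of eigenvalues is finite and nonempty. *)
definition lambda_min :: "real^'n^'n \<Rightarrow> real" where
  "lambda_min A = Min (eigenvalues A)"

definition lambda_max :: "real^'n^'n \<Rightarrow> real" where
  "lambda_max A = Max (eigenvalues A)"

definition inv_cond :: "real^'n^'n \<Rightarrow> real" where
  "inv_cond A = lambda_min A / lambda_max A"

(* The design space is the finite type 'x and the parameter space is real^'k;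
   row x of the sensitivity matrix is the gradient of F x at p. *)
definition sensitivity :: "('x \<Rightarrow> real^'k \<Rightarrow> real) \<Rightarrow> real^'k \<Rightarrow> real^'k^'x" where
  "sensitivity F p = (\<chi> x. gradient (F x) p)"

definition fisher_info :: "real^'k^'x \<Rightarrow> real^'x^'x \<Rightarrow> real^'k^'k" where
  "fisher_info G \<Gamma> = transpose G ** matrix_inv \<Gamma> ** G"

definition Y_mat :: "real^'k^'x \<Rightarrow> real^'x^'x \<Rightarrow> 'x \<Rightarrow> 'x \<Rightarrow> real^'k^'k" where
  "Y_mat G \<Gamma> x t =
     (matrix_inv \<Gamma> $ x $ t) *\<^sub>R outer (row x G) (row t G) +
     (matrix_inv \<Gamma> $ t $ x) *\<^sub>R outer (row t G) (row x G)"

definition Y_total :: "real^'k^'x \<Rightarrow> real^'x^'x \<Rightarrow> real" where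
  "Y_total G \<Gamma> = (\<Sum>x\<in>UNIV. \<Sum>t\<in>UNIV. frobenius_norm (Y_mat G \<Gamma> x t))"

definition pi_tilde :: "real^'k^'x \<Rightarrow> real^'x^'x \<Rightarrow> 'x \<Rightarrow> 'x \<Rightarrow> real" where
  "pi_tilde G \<Gamma> x t = frobenius_norm (Y_mat G \<Gamma> x t) / Y_total G \<Gamma>"

(* The samples are s 1, ..., s c. *)
definition sampled_fisher_info ::
    "real^'k^'x \<Rightarrow> real^'x^'x \<Rightarrow> ('x \<times> 'x) pmf \<Rightarrow> nat \<Rightarrow> (nat \<Rightarrow> 'x \<times> 'x) \<Rightarrow> real^'k^'k" where
  "sampled_fisher_info G \<Gamma> \<pi> c s =
     (\<Sum>j=1..c. (1 / (2 * real c * pmf \<pi> (s j))) *\<^sub>R Y_mat G \<Gamma> (fst (s j)) (snd (s j)))"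

end

theory Submission
  imports Defs
begin

text \<open>
  The sampled matrix is an average of independent matrices with mean
  \<open>I = \<Sum> Y / 2\<close>, each of Frobenius norm at most \<open>S / (2 \<beta>)\<close> with
  \<open>S = \<Sum> \<parallel>Y\<parallel>\<close>, and of variance at most \<open>S\<^sup>2 / (4 \<beta>)\<close>. Hence the mean deviation in
  Frobenius norm is at most \<open>S / (2 \<surd>(\<beta> c))\<close>, and a bounded-difference inequality for the norm of
  the sum controls the fluctuation around the mean deviation. With the given sample size the deviation is
  at most \<open>\<epsilon>\<close> with probability at least \<open>1 - \<delta>\<close>, and then Weyl's inequality bounds the
  displacement of the extreme eigenvalues by \<open>\<epsilon>\<close>.
\<close>

section \<open>Extreme eigenvalues of symmetric matrices\<close>

text \<open>Cauchy-Schwarz row by row: \<open>norm A\<close> is the L2 norm of the row norms, that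
  is, the Frobenius norm.\<close>

lemma norm_matrix_vector_mult_le:
  fixes A :: "real^'n^'m"
  shows "norm (A *v x) \<le> norm A * norm x"
proof -
  have "norm (A *v x) \<le> L2_set (\<lambda>i. norm (A $ i) * norm x) UNIV"
    unfolding norm_vec_def[of "A *v x"]
  proof (rule L2_set_mono)
    fix i
    have "(A *v x) $ i = A $ i \<bullet> x"
      by (simp add: matrix_vector_mult_def inner_vec_def)
    then show "norm ((A *v x) $ i) \<le> norm (A $ i) * norm x"
      by (simp add: Cauchy_Schwarz_ineq2)
  qed simp
  also have "\<dots> = norm A * norm x"
    by (simp add: norm_vec_def[of A] L2_set_left_distrib)
  finally show ?thesis .
qed

lemma symmetric_matrix_inner:
  fixes A :: "real^'n^'n"
  assumes "symmetric_matrix A"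
  shows "x \<bullet> (A *v y) = (A *v x) \<bullet> y"
proof -
  have "x v* A = A *v x"
    using assms unfolding symmetric_matrix_def by (metis vector_transpose_matrix)
  then show ?thesis
    by (metis dot_lmul_matrix)
qed

text \<open>If \<open>a\<close> were nonzero, the linear term would win for small \<open>t\<close>
  of opposite sign. The witness \<open>t = - a / d\<close> with \<open>d\<close> positive and above
  \<open>b\<close> makes the value \<open>(a / d)^2 * (b - 2 * d)\<close>, which is
  negative.\<close>

lemma zero_if_quadratic_nonneg:
  fixes a b :: real
  assumes "\<And>t. 2 * t * a + t\<^sup>2 * b \<ge> 0"
  shows "a = 0"
proof (rule ccontr)
  assume "a \<noteq> 0"
  define d where "d = \<bar>b\<bar> + 1"
  have d: "d > 0" "b < d" by (auto simp: d_def)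
  have "0 \<le> 2 * (- a / d) * a + (- a / d)\<^sup>2 * b" by (rule assms)
  also have "\<dots> = (a\<^sup>2 / d\<^sup>2) * (b - 2 * d)"
    using d by (simp add: field_simps power2_eq_square)
  also have "\<dots> < 0"
    using \<open>a \<noteq> 0\<close> d by (intro mult_pos_neg) auto
  finally show False by simp
qed

text \<open>
  At a minimiser \<open>v\<close> of the Rayleigh quotient with value \<open>m\<close>, the form \<open>x \<bullet> (A x) - m (x \<bullet> x)\<close>
  is nonnegative and vanishes; moving from \<open>v\<close> in the direction \<open>w = A v - m v\<close> then forces \<open>w = 0\<close>.
\<close>
lemma ex_least_rayleigh_eigenvalue:
  fixes A :: "real^'n^'n"
  assumes sym: "symmetric_matrix A"
  obtains m where "m \<in> eigenvalues A" "\<And>x. m * (x \<bullet> x) \<le> x \<bullet> (A *v x)"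
proof -
  have "continuous_on (sphere 0 1) (\<lambda>x. x \<bullet> (A *v x))"
    by (intro continuous_intros linear_continuous_on linear_linear[THEN iffD1] matrix_vector_mul_linear)
  moreover have "sphere (0 :: real^'n) 1 \<noteq> {}"
    using norm_axis_1 by (metis dist_0_norm empty_iff mem_sphere)
  ultimately obtain v where v: "norm v = 1"
      and least: "\<And>y. norm y = 1 \<Longrightarrow> v \<bullet> (A *v v) \<le> y \<bullet> (A *v y)"
    using continuous_attains_inf[of "sphere (0 :: real^'n) 1" "\<lambda>x. x \<bullet> (A *v x)"] by auto
  define m where "m = v \<bullet> (A *v v)"
  have bound: "m * (x \<bullet> x) \<le> x \<bullet> (A *v x)" for x
  proof (cases "x = 0")
    case False
    have "m \<le> (x /\<^sub>R norm x) \<bullet> (A *v (x /\<^sub>R norm x))"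
      unfolding m_def using False by (intro least) simp
    also have "\<dots> = (x \<bullet> (A *v x)) / (norm x)\<^sup>2"
      by (simp add: matrix_vector_mult_scaleR power2_eq_square field_simps)
    finally show ?thesis
      using False by (simp add: field_simps power2_norm_eq_inner)
  qed simp
  define w where "w = A *v v - m *\<^sub>R v"
  have "v \<bullet> v = 1" using v by (simp add: norm_eq_1)
  have "w \<bullet> w = 0"
  proof (rule zero_if_quadratic_nonneg)
    fix t
    have "0 \<le> (v + t *\<^sub>R w) \<bullet> (A *v (v + t *\<^sub>R w)) - m * ((v + t *\<^sub>R w) \<bullet> (v + t *\<^sub>R w))"
      using bound[of "v + t *\<^sub>R w"] by simp
    \<comment> \<open>The constant term vanishes because \<open>v\<close> attains the value
      \<open>m\<close> on the unit sphere, and symmetry of \<open>A\<close> merges the two cross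
      terms.\<close>
    also have "\<dots> = 2 * t * (w \<bullet> (A *v v) - m * (w \<bullet> v)) + t\<^sup>2 * (w \<bullet> (A *v w) - m * (w \<bullet> w))"
      using symmetric_matrix_inner[OF sym, of v w] \<open>v \<bullet> v = 1\<close>
      by (simp add: matrix_vector_right_distrib matrix_vector_mult_scaleR inner_add
          inner_commute algebra_simps power2_eq_square m_def[symmetric])
    also have "w \<bullet> (A *v v) - m * (w \<bullet> v) = w \<bullet> w"
      by (simp add: w_def inner_diff_right)
    finally show "2 * t * (w \<bullet> w) + t\<^sup>2 * (w \<bullet> (A *v w) - m * (w \<bullet> w)) \<ge> 0" .
  qed
  then have "A *v v = m *\<^sub>R v"
    by (simp add: w_def)
  moreover have "v \<noteq> 0" using v by auto
  ultimately have "m \<in> eigenvalues A"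
    unfolding eigenvalues_def by blast
  then show thesis using bound that by blast
qed

lemma symmetric_matrix_uminus: "symmetric_matrix A \<Longrightarrow> symmetric_matrix (- A)"
  by (simp add: symmetric_matrix_def transpose_def vec_eq_iff)

lemma matrix_vector_mult_minus_left: "(- A) *v x = - (A *v x :: real^'n)"
  by (simp add: vec_eq_iff matrix_vector_mult_def sum_negf)

lemma ex_greatest_rayleigh_eigenvalue:
  fixes A :: "real^'n^'n"
  assumes "symmetric_matrix A"
  obtains m where "m \<in> eigenvalues A" "\<And>x. x \<bullet> (A *v x) \<le> m * (x \<bullet> x)"
proof -
  obtain m where m: "m \<in> eigenvalues (- A)" "\<And>x. m * (x \<bullet> x) \<le> x \<bullet> ((- A) *v x)"
    using ex_least_rayleigh_eigenvalue symmetric_matrix_uminus[OF assms] by metis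
  show thesis
  proof
    show "- m \<in> eigenvalues A"
      using m(1) by (auto simp: eigenvalues_def matrix_vector_mult_minus_left minus_equation_iff)
         (metis minus_equation_iff)
    show "x \<bullet> (A *v x) \<le> - m * (x \<bullet> x)" for x
      using m(2)[of x] by (simp add: matrix_vector_mult_minus_left)
  qed
qed

text \<open>Eigenvectors for distinct eigenvalues are orthogonal, so choosing one per eigenvalue
  gives an injective family with independent range, which is finite in finite dimension. This makes
  \<open>Min\<close> and \<open>Max\<close> of the spectrum meaningful.\<close>

lemma finite_eigenvalues:
  fixes A :: "real^'n^'n"
  assumes "symmetric_matrix A"
  shows "finite (eigenvalues A)"
proof -
  have "\<forall>l\<in>eigenvalues A. \<exists>v. v \<noteq> 0 \<and> A *v v = l *\<^sub>R v"
    by (simp add: eigenvalues_def)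
  then obtain v where v: "\<And>l. l \<in> eigenvalues A \<Longrightarrow> v l \<noteq> 0 \<and> A *v v l = l *\<^sub>R v l"
    by (metis (no_types, lifting))
  have orth: "v k \<bullet> v l = 0" if "k \<in> eigenvalues A" "l \<in> eigenvalues A" "k \<noteq> l" for k l
    using symmetric_matrix_inner[OF assms, of "v k" "v l"] v[OF that(1)] v[OF that(2)] that(3)
    by simp
  have inj: "inj_on v (eigenvalues A)"
    using orth v by (intro inj_onI) (metis inner_eq_zero_iff)
  have "independent (v ` eigenvalues A)"
    using orth v by (intro pairwise_orthogonal_independent)
       (fastforce simp: pairwise_def orthogonal_def)+
  then show ?thesis
    using independent_imp_finite finite_imageD inj by blast
qed

lemma lambda_min_in:
  assumes "symmetric_matrix A"
  shows "lambda_min A \<in> eigenvalues A"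
  unfolding lambda_min_def using ex_least_rayleigh_eigenvalue[OF assms] finite_eigenvalues[OF assms]
  by (metis Min_in empty_iff)

lemma lambda_max_in:
  assumes "symmetric_matrix A"
  shows "lambda_max A \<in> eigenvalues A"
  unfolding lambda_max_def using ex_least_rayleigh_eigenvalue[OF assms] finite_eigenvalues[OF assms]
  by (metis Max_in empty_iff)

lemma lambda_min_le_lambda_max:
  assumes "symmetric_matrix A"
  shows "lambda_min A \<le> lambda_max A"
  unfolding lambda_max_def
  by (intro Max_ge finite_eigenvalues lambda_min_in assms)

text \<open>The minimum of the Rayleigh quotient is itself an eigenvalue, so the smallest eigenvalue
  cannot exceed it.\<close>

lemma lambda_min_rayleigh:
  assumes "symmetric_matrix A"
  shows "lambda_min A * (x \<bullet> x) \<le> x \<bullet> (A *v x)"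
proof -
  obtain m where m: "m \<in> eigenvalues A" "m * (x \<bullet> x) \<le> x \<bullet> (A *v x)"
    using ex_least_rayleigh_eigenvalue[OF assms] by metis
  have "lambda_min A \<le> m"
    unfolding lambda_min_def by (intro Min_le finite_eigenvalues assms m)
  then show ?thesis
    using m(2) mult_right_mono[of "lambda_min A" m "x \<bullet> x"] by simp
qed

lemma lambda_max_rayleigh:
  assumes "symmetric_matrix A"
  shows "x \<bullet> (A *v x) \<le> lambda_max A * (x \<bullet> x)"
proof -
  obtain m where m: "m \<in> eigenvalues A" "x \<bullet> (A *v x) \<le> m * (x \<bullet> x)"
    using ex_greatest_rayleigh_eigenvalue[OF assms] by metis
  have "m \<le> lambda_max A"
    unfolding lambda_max_def by (intro Max_ge finite_eigenvalues assms m)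
  then show ?thesis
    using m(2) mult_right_mono[of m "lambda_max A" "x \<bullet> x"] by simp
qed

section \<open>Perturbation of the extreme eigenvalues and of the inverse condition number\<close>

lemma abs_quadratic_form_le:
  fixes A :: "real^'n^'n"
  shows "\<bar>x \<bullet> (A *v x)\<bar> \<le> norm A * (x \<bullet> x)"
proof -
  have "\<bar>x \<bullet> (A *v x)\<bar> \<le> norm x * (norm A * norm x)"
    by (intro order_trans[OF Cauchy_Schwarz_ineq2] mult_left_mono norm_matrix_vector_mult_le) simp
  then show ?thesis
    by (simp add: dot_square_norm power2_eq_square algebra_simps)
qed

text \<open>One half of Weyl's inequality: an eigenvector of \<open>B\<close> for its smallest
  eigenvalue is tested against the Rayleigh bound of \<open>A\<close>, and the form of
  \<open>B - A\<close> costs at most its norm.\<close>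

lemma lambda_min_perturbation:
  assumes A: "symmetric_matrix A" and B: "symmetric_matrix B"
  shows "lambda_min A - norm (B - A) \<le> lambda_min B"
proof -
  obtain v where v: "v \<noteq> 0" "B *v v = lambda_min B *\<^sub>R v"
    using lambda_min_in[OF B] by (auto simp: eigenvalues_def)
  have "lambda_min B * (v \<bullet> v) = v \<bullet> (A *v v) + v \<bullet> ((B - A) *v v)"
    using v by (simp add: matrix_vector_mult_diff_rdistrib inner_diff_right)
  moreover have "lambda_min A * (v \<bullet> v) \<le> v \<bullet> (A *v v)"
    by (rule lambda_min_rayleigh[OF A])
  ultimately have "(lambda_min A - norm (B - A)) * (v \<bullet> v) \<le> lambda_min B * (v \<bullet> v)"
    using abs_quadratic_form_le[of v "B - A"] by (simp add: algebra_simps)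
  then show ?thesis
    using v(1) by simp
qed

lemma lambda_max_perturbation:
  assumes A: "symmetric_matrix A" and B: "symmetric_matrix B"
  shows "lambda_max B \<le> lambda_max A + norm (B - A)"
proof -
  obtain v where v: "v \<noteq> 0" "B *v v = lambda_max B *\<^sub>R v"
    using lambda_max_in[OF B] by (auto simp: eigenvalues_def)
  have "lambda_max B * (v \<bullet> v) = v \<bullet> (A *v v) + v \<bullet> ((B - A) *v v)"
    using v by (simp add: matrix_vector_mult_diff_rdistrib inner_diff_right)
  moreover have "v \<bullet> (A *v v) \<le> lambda_max A * (v \<bullet> v)"
    by (rule lambda_max_rayleigh[OF A])
  ultimately have "lambda_max B * (v \<bullet> v) \<le> (lambda_max A + norm (B - A)) * (v \<bullet> v)"
    using abs_quadratic_form_le[of v "B - A"] by (simp add: algebra_simps)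
  then show ?thesis
    using v(1) by simp
qed

text \<open>The eigenvalue bounds give at least \<open>(m - e) / (n + e)\<close> with
  \<open>m\<close>, \<open>n\<close> the extreme eigenvalues of \<open>A\<close>. Comparing this
  with the claim reduces to \<open>m * (n + e) \<le> n * (m + e)\<close>, which is
  \<open>m \<le> n\<close> multiplied by \<open>e\<close>.\<close>

lemma inv_cond_perturbation:
  assumes A: "symmetric_matrix A" and B: "symmetric_matrix B"
    and e: "norm (B - A) \<le> e" "e < lambda_min A"
  shows "inv_cond A * ((lambda_min A - e) / (lambda_min A + e)) \<le> inv_cond B"
proof -
  define m where "m = lambda_min A"
  define n where "n = lambda_max A"
  have mn: "m \<le> n" "0 \<le> e" "e < m"
    using lambda_min_le_lambda_max[OF A] e order_trans[OF norm_ge_zero e(1)] by (simp_all add: m_def n_def)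
  have lo: "m - e \<le> lambda_min B" and hi: "lambda_max B \<le> n + e"
    using lambda_min_perturbation[OF A B] lambda_max_perturbation[OF A B] e by (auto simp: m_def n_def)
  have "0 < lambda_max B"
    using lo mn lambda_min_le_lambda_max[OF B] by linarith
  have "m / n * ((m - e) / (m + e)) = (m - e) * (m / (n * (m + e)))"
    by simp
  also have "\<dots> \<le> (m - e) * (1 / (n + e))"
  proof (rule mult_left_mono)
    have "m * (n + e) \<le> n * (m + e)"
      using mn mult_right_mono[of m n e] by (simp add: algebra_simps)
    then show "m / (n * (m + e)) \<le> 1 / (n + e)"
      using mn by (subst frac_le_eq) (simp_all add: divide_nonpos_pos)
  qed (use mn in simp)
  also have "\<dots> \<le> lambda_min B / lambda_max B"
    using lo hi mn \<open>0 < lambda_max B\<close> by (simp add: frac_le)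
  finally show ?thesis
    by (simp add: inv_cond_def m_def n_def)
qed

section \<open>Concentration of norms of sums of independent vectors\<close>

text \<open>A function of oscillation at most \<open>D\<close> takes its values in
  \<open>{a..a + D}\<close>, where \<open>a\<close> is its minimum over the finite type. Hoeffding's
  lemma then bounds the centred variable, and the mean is moved to the right-hand side.\<close>

lemma Hoeffdings_lemma_pmf:
  fixes g :: "'a::finite \<Rightarrow> real"
  assumes l: "l > 0" and osc: "\<And>x y. \<bar>g x - g y\<bar> \<le> D"
  shows "measure_pmf.expectation p (\<lambda>x. exp (l * g x))
      \<le> exp (l * measure_pmf.expectation p g + l\<^sup>2 * D\<^sup>2 / 8)"
proof -
  define a where "a = Min (range g)"
  have "a \<in> range g"
    unfolding a_def by (rule Min_in) auto
  then obtain x0 where x0: "a = g x0"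
    by auto
  have "g x \<in> {a..a + D}" for x
    using osc[of x x0] Min_le[of "range g" "g x"] unfolding a_def[symmetric] x0[symmetric] by auto
  then interpret interval_bounded_random_variable "measure_pmf p" g a "a + D"
    by unfold_locales auto
  have "ennreal (measure_pmf.expectation p (\<lambda>x. exp (l * (g x - measure_pmf.expectation p g))))
      = (\<integral>\<^sup>+x. ennreal (exp (l * (g x - measure_pmf.expectation p g))) \<partial>measure_pmf p)"
    by (subst nn_integral_eq_integral) (simp_all add: integrable_measure_pmf_finite)
  also have "\<dots> \<le> ennreal (exp (l\<^sup>2 * (a + D - a)\<^sup>2 / 8))"
    by (rule Hoeffdings_lemma_nn_integral[OF l])
  finally have "measure_pmf.expectation p (\<lambda>x. exp (l * (g x - measure_pmf.expectation p g))) \<le> exp (l\<^sup>2 * D\<^sup>2 / 8)"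
    by simp
  moreover have "measure_pmf.expectation p (\<lambda>x. exp (l * (g x - measure_pmf.expectation p g)))
      = measure_pmf.expectation p (\<lambda>x. exp (l * g x)) / exp (l * measure_pmf.expectation p g)"
    by (simp add: right_diff_distrib exp_diff)
  ultimately have "measure_pmf.expectation p (\<lambda>x. exp (l * g x)) / exp (l * measure_pmf.expectation p g)
      \<le> exp (l\<^sup>2 * D\<^sup>2 / 8)"
    by simp
  then show ?thesis
    by (simp add: exp_add pos_divide_le_eq mult.commute)
qed

text \<open>Finite support makes every real function of the sample integrable.\<close>

lemma finite_set_Pi_pmf:
  fixes p :: "'i \<Rightarrow> 'a::finite pmf"
  assumes "finite I"
  shows "finite (set_pmf (Pi_pmf I dflt p))"
  using set_Pi_pmf_subset'[OF assms, of dflt p]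
  by (rule finite_subset) (use assms in auto)

lemma expectation_Pi_pmf_sum_Suc:
  fixes p :: "'a::finite pmf" and Z :: "'a \<Rightarrow> 'b::euclidean_space" and h :: "'b \<Rightarrow> real"
  shows "measure_pmf.expectation (Pi_pmf {1..Suc n} d (\<lambda>_. p)) (\<lambda>f. h (v + (\<Sum>j=1..Suc n. Z (f j))))
    = measure_pmf.expectation (Pi_pmf {1..n} d (\<lambda>_. p))
        (\<lambda>f. measure_pmf.expectation p (\<lambda>a. h (v + (\<Sum>j=1..n. Z (f j)) + Z a)))"
proof -
  let ?P = "Pi_pmf {1..n} d (\<lambda>_. p)"
  have fin: "finite (set_pmf ?P)"
    by (rule finite_set_Pi_pmf) simp
  have ins: "{1..Suc n} = insert (Suc n) {1..n}" by auto
  \<comment> \<open>The insertion rule draws the new coordinate first; commuting the two draws puts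
    it last, so that it is averaged for a fixed partial sum.\<close>
  have "Pi_pmf {1..Suc n} d (\<lambda>_. p)
      = bind_pmf ?P (\<lambda>f. map_pmf (\<lambda>a. f(Suc n := a)) p)"
    unfolding ins by (subst Pi_pmf_insert') (simp_all add: map_pmf_def bind_commute_pmf[of p])
  then have "measure_pmf.expectation (Pi_pmf {1..Suc n} d (\<lambda>_. p)) (\<lambda>f. h (v + (\<Sum>j=1..Suc n. Z (f j))))
    = (\<Sum>f\<in>set_pmf ?P. pmf ?P f *\<^sub>R measure_pmf.expectation (map_pmf (\<lambda>a. f(Suc n := a)) p) 
          (\<lambda>f. h (v + (\<Sum>j=1..Suc n. Z (f j)))))"
    by (simp only:) (intro pmf_expectation_bind fin, auto)
  also have "\<dots> = (\<Sum>f\<in>set_pmf ?P. pmf ?P f *\<^sub>R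
      measure_pmf.expectation p (\<lambda>a. h (v + (\<Sum>j=1..n. Z (f j)) + Z a)))"
    by (simp add: add.assoc)
  also have "\<dots> = measure_pmf.expectation ?P
        (\<lambda>f. measure_pmf.expectation p (\<lambda>a. h (v + (\<Sum>j=1..n. Z (f j)) + Z a)))"
    by (rule integral_measure_pmf[symmetric, OF fin]) auto
  finally show ?thesis .
qed

text \<open>
  Averaging a 1-Lipschitz function over one summand gives a 1-Lipschitz function again, so the summands
  can be integrated out one at a time, each by Hoeffding's lemma.
\<close>
lemma exp_moment_lipschitz_sum:
  fixes p :: "'a::finite pmf" and Z :: "'a \<Rightarrow> 'b::euclidean_space" and h :: "'b \<Rightarrow> real"
  assumes l: "l > 0" and osc: "\<And>x y. norm (Z x - Z y) \<le> D"
    and lip: "\<And>u w. \<bar>h u - h w\<bar> \<le> norm (u - w)"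
  shows "measure_pmf.expectation (Pi_pmf {1..n} d (\<lambda>_. p)) (\<lambda>f. exp (l * h (v + (\<Sum>j=1..n. Z (f j)))))
    \<le> exp (l * measure_pmf.expectation (Pi_pmf {1..n} d (\<lambda>_. p)) (\<lambda>f. h (v + (\<Sum>j=1..n. Z (f j))))
        + real n * (l\<^sup>2 * D\<^sup>2 / 8))"
  using lip
proof (induction n arbitrary: h)
  case 0
  then show ?case by simp
next
  case (Suc n)
  let ?P = "Pi_pmf {1..n} d (\<lambda>_. p)"
  have fin: "finite (set_pmf ?P)"
    by (rule finite_set_Pi_pmf) simp
  have intp: "integrable (measure_pmf p) g" for g :: "'a \<Rightarrow> real"
    by (intro integrable_measure_pmf_finite) simp
  define h' where "h' = (\<lambda>u. measure_pmf.expectation p (\<lambda>a. h (u + Z a)))"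
  have lip': "\<bar>h' u - h' w\<bar> \<le> norm (u - w)" for u w
  proof -
    have "\<bar>h' u - h' w\<bar> = \<bar>measure_pmf.expectation p (\<lambda>a. h (u + Z a) - h (w + Z a))\<bar>"
      by (simp add: h'_def intp)
    also have "\<dots> \<le> measure_pmf.expectation p (\<lambda>a. \<bar>h (u + Z a) - h (w + Z a)\<bar>)"
      by (rule integral_abs_bound)
    also have "\<dots> \<le> measure_pmf.expectation p (\<lambda>a. norm (u - w))"
    proof (intro integral_mono intp)
      show "\<bar>h (u + Z a) - h (w + Z a)\<bar> \<le> norm (u - w)" for a
        using Suc.prems[of "u + Z a" "w + Z a"] by simp
    qed
    finally show ?thesis by simp
  qed
  \<comment> \<open>For a fixed partial sum \<open>u\<close>, the Lipschitz property turns the bound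
    on differences of \<open>Z\<close> into a bound \<open>D\<close> on the oscillation of
    \<open>h (u + Z a)\<close>.\<close>
  have step: "measure_pmf.expectation p (\<lambda>a. exp (l * h (u + Z a))) \<le> exp (l * h' u) * exp (l\<^sup>2 * D\<^sup>2 / 8)" for u
  proof -
    have "\<bar>h (u + Z a) - h (u + Z b)\<bar> \<le> D" for a b
      using Suc.prems[of "u + Z a" "u + Z b"] osc[of a b] by simp
    from Hoeffdings_lemma_pmf[OF l this, of p] show ?thesis
      by (simp add: h'_def exp_add)
  qed
  have "measure_pmf.expectation (Pi_pmf {1..Suc n} d (\<lambda>_. p)) (\<lambda>f. exp (l * h (v + (\<Sum>j=1..Suc n. Z (f j)))))
     = measure_pmf.expectation ?P
        (\<lambda>f. measure_pmf.expectation p (\<lambda>a. exp (l * h (v + (\<Sum>j=1..n. Z (f j)) + Z a))))"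
    by (rule expectation_Pi_pmf_sum_Suc)
  also have "\<dots> \<le> measure_pmf.expectation ?P
        (\<lambda>f. exp (l * h' (v + (\<Sum>j=1..n. Z (f j)))) * exp (l\<^sup>2 * D\<^sup>2 / 8))"
    by (intro integral_mono integrable_measure_pmf_finite fin step)
  also have "\<dots> \<le> exp (l * measure_pmf.expectation ?P (\<lambda>f. h' (v + (\<Sum>j=1..n. Z (f j))))
        + real n * (l\<^sup>2 * D\<^sup>2 / 8)) * exp (l\<^sup>2 * D\<^sup>2 / 8)"
    using Suc.IH[of h', OF lip'] by simp
  also have "\<dots> = exp (l * measure_pmf.expectation ?P (\<lambda>f. h' (v + (\<Sum>j=1..n. Z (f j))))
        + real (Suc n) * (l\<^sup>2 * D\<^sup>2 / 8))"
    by (simp add: exp_add[symmetric] field_simps)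
  also have "measure_pmf.expectation ?P (\<lambda>f. h' (v + (\<Sum>j=1..n. Z (f j))))
     = measure_pmf.expectation (Pi_pmf {1..Suc n} d (\<lambda>_. p)) (\<lambda>f. h (v + (\<Sum>j=1..Suc n. Z (f j))))"
    unfolding h'_def by (rule expectation_Pi_pmf_sum_Suc[symmetric])
  finally show ?case .
qed

text \<open>Pythagoras in the mean: each new summand is independent of the partial sum and centred,
  so the cross term has expectation zero.\<close>

lemma second_moment_sum:
  fixes p :: "'a::finite pmf" and Z :: "'a \<Rightarrow> 'b::euclidean_space"
  assumes mean: "measure_pmf.expectation p Z = 0"
  shows "measure_pmf.expectation (Pi_pmf {1..n} d (\<lambda>_. p)) (\<lambda>f. (norm (v + (\<Sum>j=1..n. Z (f j))))\<^sup>2)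
     = (norm v)\<^sup>2 + real n * measure_pmf.expectation p (\<lambda>a. (norm (Z a))\<^sup>2)"
proof (induction n)
  case 0
  then show ?case by simp
next
  case (Suc n)
  let ?P = "Pi_pmf {1..n} d (\<lambda>_. p)"
  have fin: "finite (set_pmf ?P)"
    by (rule finite_set_Pi_pmf) simp
  have step: "measure_pmf.expectation p (\<lambda>a. (norm (u + Z a))\<^sup>2)
      = (norm u)\<^sup>2 + measure_pmf.expectation p (\<lambda>a. (norm (Z a))\<^sup>2)" for u
  proof -
    have "measure_pmf.expectation p (\<lambda>a. (norm (u + Z a))\<^sup>2)
        = measure_pmf.expectation p (\<lambda>a. (norm u)\<^sup>2 + 2 * (u \<bullet> Z a) + (norm (Z a))\<^sup>2)"
      by (intro Bochner_Integration.integral_cong)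
        (auto simp: power2_norm_eq_inner inner_add inner_commute)
    also have "\<dots> = (norm u)\<^sup>2 + 2 * (u \<bullet> measure_pmf.expectation p Z) + measure_pmf.expectation p (\<lambda>a. (norm (Z a))\<^sup>2)"
      by (simp add: integrable_measure_pmf_finite)
    finally show ?thesis by (simp add: mean)
  qed
  have "measure_pmf.expectation (Pi_pmf {1..Suc n} d (\<lambda>_. p)) (\<lambda>f. (norm (v + (\<Sum>j=1..Suc n. Z (f j))))\<^sup>2)
    = measure_pmf.expectation ?P (\<lambda>f. (norm (v + (\<Sum>j=1..n. Z (f j))))\<^sup>2
         + measure_pmf.expectation p (\<lambda>a. (norm (Z a))\<^sup>2))"
    by (subst expectation_Pi_pmf_sum_Suc[where h="\<lambda>u. (norm u)\<^sup>2"]) (simp only: step)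
  also have "\<dots> = (norm v)\<^sup>2 + real (Suc n) * measure_pmf.expectation p (\<lambda>a. (norm (Z a))\<^sup>2)"
    using Suc.IH by (simp add: integrable_measure_pmf_finite fin algebra_simps del: One_nat_def)
  finally show ?case .
qed

lemma mean_norm_sum_le:
  fixes p :: "'a::finite pmf" and Z :: "'a \<Rightarrow> 'b::euclidean_space"
  assumes mean: "measure_pmf.expectation p Z = 0"
    and var: "measure_pmf.expectation p (\<lambda>a. (norm (Z a))\<^sup>2) \<le> V"
  shows "measure_pmf.expectation (Pi_pmf {1..n} d (\<lambda>_. p)) (\<lambda>f. norm (\<Sum>j=1..n. Z (f j))) \<le> sqrt (real n * V)"
proof (rule real_le_rsqrt)
  let ?P = "Pi_pmf {1..n} d (\<lambda>_. p)" and ?N = "\<lambda>f. norm (\<Sum>j=1..n. Z (f j))"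
  have int: "integrable ?P g" for g :: "_ \<Rightarrow> real"
    by (intro integrable_measure_pmf_finite finite_set_Pi_pmf) simp
  \<comment> \<open>Nonnegativity of the variance serves as Jensen's inequality for the
    square.\<close>
  have "0 \<le> measure_pmf.variance ?P ?N"
    by (intro Bochner_Integration.integral_nonneg) simp
  also have "\<dots> = measure_pmf.expectation ?P (\<lambda>f. (?N f)\<^sup>2) - (measure_pmf.expectation ?P ?N)\<^sup>2"
    by (intro measure_pmf.variance_eq int)
  finally have "(measure_pmf.expectation ?P ?N)\<^sup>2 \<le> measure_pmf.expectation ?P (\<lambda>f. (?N f)\<^sup>2)"
    by simp
  also have "\<dots> = real n * measure_pmf.expectation p (\<lambda>a. (norm (Z a))\<^sup>2)"
    using second_moment_sum[OF mean, of n d 0] by simp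
  also have "\<dots> \<le> real n * V"
    using var by (intro mult_left_mono) auto
  finally show "(measure_pmf.expectation ?P ?N)\<^sup>2 \<le> real n * V" .
qed

text \<open>Chernoff's method: Markov's inequality for \<open>exp (l * N)\<close> with
  \<open>N\<close> the norm of the sum, then the exponential moment bound, since the norm is
  1-Lipschitz, and finally the bound on the mean of \<open>N\<close>.\<close>

lemma prob_norm_sum_ge_le:
  fixes p :: "'a::finite pmf" and Z :: "'a \<Rightarrow> 'b::euclidean_space"
  assumes mean: "measure_pmf.expectation p Z = 0"
    and var: "measure_pmf.expectation p (\<lambda>a. (norm (Z a))\<^sup>2) \<le> V"
    and osc: "\<And>x y. norm (Z x - Z y) \<le> D"
    and pos: "n > 0" "D > 0" "t > 0"
  shows "measure_pmf.prob (Pi_pmf {1..n} d (\<lambda>_. p)) {f. norm (\<Sum>j=1..n. Z (f j)) \<ge> sqrt (real n * V) + t}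
     \<le> exp (- 2 * t\<^sup>2 / (real n * D\<^sup>2))"
proof -
  let ?P = "Pi_pmf {1..n} d (\<lambda>_. p)" and ?N = "\<lambda>f. norm (\<Sum>j=1..n. Z (f j))"
  define l where "l = 4 * t / (real n * D\<^sup>2)" \<comment> \<open>minimises the Chernoff exponent\<close>
  define q where "q = sqrt (real n * V) + t"
  have l: "l > 0" using pos by (simp add: l_def)
  have int: "integrable ?P g" for g :: "_ \<Rightarrow> real"
    by (intro integrable_measure_pmf_finite finite_set_Pi_pmf) simp
  have "measure_pmf.prob ?P {f. ?N f \<ge> q}
      = measure_pmf.prob ?P {f \<in> space ?P. exp (l * ?N f) \<ge> exp (l * q)}"
    using l by simp
  also have "\<dots> \<le> measure_pmf.expectation ?P (\<lambda>f. exp (l * ?N f)) / exp (l * q)"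
    by (rule integral_Markov_inequality_measure[of _ _ UNIV, OF int]) auto
  also have "\<dots> \<le> exp (l * measure_pmf.expectation ?P ?N + real n * (l\<^sup>2 * D\<^sup>2 / 8)) / exp (l * q)"
    using exp_moment_lipschitz_sum[OF l osc norm_triangle_ineq3, where v=0]
    by (intro divide_right_mono) auto
  also have "\<dots> \<le> exp (l * sqrt (real n * V) + real n * (l\<^sup>2 * D\<^sup>2 / 8)) / exp (l * q)"
    using mean_norm_sum_le[OF mean var, of n d] l by (intro divide_right_mono) auto
  also have "\<dots> = exp (real n * (l\<^sup>2 * D\<^sup>2 / 8) - l * t)"
    by (simp add: exp_diff[symmetric] q_def algebra_simps)
  \<comment> \<open>At this \<open>l\<close> the quadratic term is
    \<open>2 * t^2 / (n * D^2)\<close>, exactly half of \<open>l * t\<close>.\<close>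
  also have "real n * (l\<^sup>2 * D\<^sup>2 / 8) - l * t = - 2 * t\<^sup>2 / (real n * D\<^sup>2)"
    using pos by (simp add: l_def field_simps power2_eq_square)
  finally show ?thesis
    by (simp add: q_def)
qed

text \<open>Moves an event about abstract independent samples to the product distribution. Both
  sides have the same joint law on the coordinates in \<open>I\<close>, and \<open>Q\<close> depends
  on those alone.\<close>

lemma (in prob_space) prob_iid_eq_Pi_pmf:
  fixes s :: "'i \<Rightarrow> 'a \<Rightarrow> 'b::finite"
  assumes I: "finite I" "I \<noteq> {}"
    and indep: "indep_vars (\<lambda>_. count_space UNIV) s I"
    and distr: "\<And>i. i \<in> I \<Longrightarrow> distr M (count_space UNIV) (s i) = measure_pmf (p i)"
    and Q: "\<And>f g. (\<And>i. i \<in> I \<Longrightarrow> f i = g i) \<Longrightarrow> Q f = Q g"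
  shows "prob {\<omega> \<in> space M. Q (\<lambda>i. s i \<omega>)} = measure_pmf.prob (Pi_pmf I d p) {f. Q f}"
proof -
  let ?S = "PiM I (\<lambda>_. count_space (UNIV :: 'b set))"
  \<comment> \<open>A finite product of discrete spaces is discrete, so the event below is
    measurable for arbitrary \<open>Q\<close>.\<close>
  have S: "?S = count_space (PiE I (\<lambda>_. UNIV))"
    using count_space_PiM_finite[OF I(1), of "\<lambda>_. UNIV :: 'b set"] by simp
  have rv: "random_variable (count_space UNIV) (s i)" if "i \<in> I" for i
    using indep that by (simp add: indep_vars_def2)
  have "distr M ?S (\<lambda>\<omega>. \<lambda>i\<in>I. s i \<omega>) = PiM I (\<lambda>i. distr M (count_space UNIV) (s i))"
    using indep_vars_iff_distr_eq_PiM'[of I s "\<lambda>_. count_space UNIV"] I(2) rv indep by blast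
  also have "\<dots> = PiM I (\<lambda>i. measure_pmf (p i))"
    by (intro PiM_cong distr refl)
  also have "\<dots> = PiM I (\<lambda>i. distr (Pi_pmf I d p) (count_space UNIV) (\<lambda>f. f i))"
    by (intro PiM_cong refl)
      (simp add: map_pmf_rep_eq[symmetric] Pi_pmf_component I)
  also have "\<dots> = distr (Pi_pmf I d p) ?S (\<lambda>f. \<lambda>i\<in>I. f i)"
    using prob_space.indep_vars_iff_distr_eq_PiM'[OF measure_pmf.prob_space_axioms I(2), of "\<lambda>i f. f i" "Pi_pmf I d p" "\<lambda>_. count_space UNIV"]
      indep_vars_Pi_pmf[OF I(1), of d p] by simp
  finally have eq: "distr M ?S (\<lambda>\<omega>. \<lambda>i\<in>I. s i \<omega>) = distr (Pi_pmf I d p) ?S (\<lambda>f. \<lambda>i\<in>I. f i)" .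
  \<comment> \<open>Outside \<open>I\<close> a draw from \<open>Pi_pmf\<close> has value
    \<open>d\<close>, whereas the joint law lives on restricted functions. Passing to restrictions
    reconciles the two.\<close>
  let ?E = "{f \<in> PiE I (\<lambda>_. UNIV). Q f}"
  have E: "?E \<in> sets ?S" unfolding S by auto
  have Qr: "Q (restrict f I) = Q f" for f
    by (rule Q) simp
  have "prob {\<omega> \<in> space M. Q (\<lambda>i. s i \<omega>)} = measure (distr M ?S (\<lambda>\<omega>. \<lambda>i\<in>I. s i \<omega>)) ?E"
    using E by (subst measure_distr)
      (auto intro!: measurable_restrict rv arg_cong[where f=prob] simp: Qr)
  also have "\<dots> = measure_pmf.prob (Pi_pmf I d p) {f. Q f}"
    unfolding eq using E by (subst measure_distr)
      (auto intro!: arg_cong[where f="measure_pmf.prob (Pi_pmf I d p)"] simp: Qr space_PiM)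
  finally show ?thesis .
qed

section \<open>Sampled Fisher information\<close>

lemma matrix_inv_inverse:
  assumes "invertible (A :: real^'n^'n)"
  shows "A ** matrix_inv A = mat 1 \<and> matrix_inv A ** A = mat 1"
  using assms unfolding matrix_inv_def invertible_def by (rule someI_ex)

lemma sym_pos_def_invertible:
  assumes "sym_pos_def A"
  shows "invertible A"
proof -
  have "x = 0" if "A *v x = 0" for x
    using assms that unfolding sym_pos_def_def by (metis inner_zero_right less_irrefl)
  then have "inj ((*v) A)"
    using matrix_left_invertible_ker matrix_left_invertible_injective by metis
  then show ?thesis
    using invertible_left_inverse matrix_left_invertible_injective by blast
qed

text \<open>Transposing \<open>A ** matrix_inv A = mat 1\<close> shows that the transposed inverse
  is a left inverse of \<open>A\<close>, hence equal to the inverse.\<close>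

lemma symmetric_matrix_inv:
  assumes "sym_pos_def A"
  shows "symmetric_matrix (matrix_inv A)"
proof -
  have sym: "transpose A = A"
    using assms by (simp add: sym_pos_def_def symmetric_matrix_def)
  have inv: "A ** matrix_inv A = mat 1" "matrix_inv A ** A = mat 1"
    using matrix_inv_inverse[OF sym_pos_def_invertible[OF assms]] by auto
  have "transpose (matrix_inv A) ** A = mat 1"
    using arg_cong[OF inv(1), of transpose] by (simp add: matrix_transpose_mul sym)
  then have "transpose (matrix_inv A) = transpose (matrix_inv A) ** (A ** matrix_inv A)"
    by (simp add: inv)
  also have "\<dots> = matrix_inv A"
    using \<open>transpose (matrix_inv A) ** A = mat 1\<close> by (simp add: matrix_mul_assoc)
  finally show ?thesis
    by (simp add: symmetric_matrix_def)
qed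

lemma symmetric_matrix_Y_mat:
  assumes "symmetric_matrix (matrix_inv \<Gamma>)"
  shows "symmetric_matrix (Y_mat G \<Gamma> x t)"
proof -
  have "matrix_inv \<Gamma> $ x $ t = matrix_inv \<Gamma> $ t $ x"
    using assms by (simp add: symmetric_matrix_def transpose_def vec_eq_iff)
  then show ?thesis
    by (simp add: symmetric_matrix_def Y_mat_def outer_def transpose_def vec_eq_iff)
qed

lemma symmetric_matrix_scaleR:
  "symmetric_matrix A \<Longrightarrow> symmetric_matrix (r *\<^sub>R A)"
  by (simp add: symmetric_matrix_def transpose_def vec_eq_iff)

lemma symmetric_matrix_sum:
  assumes "\<And>i. i \<in> I \<Longrightarrow> symmetric_matrix (A i)"
  shows "symmetric_matrix (\<Sum>i\<in>I. A i)"
  using assms by (simp add: symmetric_matrix_def transpose_def vec_eq_iff)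

text \<open>The two summands of \<open>Y_mat\<close> are exchanged by swapping \<open>x\<close> and
  \<open>t\<close>, so over all ordered pairs each contributes the full Fisher information; the
  factor \<open>1 / 2\<close> corrects the double count.\<close>

lemma fisher_info_eq_sum_Y_mat:
  "fisher_info G \<Gamma> = (\<Sum>x\<in>UNIV. \<Sum>t\<in>UNIV. (1 / 2) *\<^sub>R Y_mat G \<Gamma> x t)"
proof -
  let ?W = "matrix_inv \<Gamma>"
  have "fisher_info G \<Gamma> $ i $ j = (\<Sum>x\<in>UNIV. \<Sum>t\<in>UNIV. (1 / 2) *\<^sub>R Y_mat G \<Gamma> x t) $ i $ j" for i j
  proof -
    have "fisher_info G \<Gamma> $ i $ j = (\<Sum>t\<in>UNIV. \<Sum>x\<in>UNIV. ?W $ x $ t * (G $ x $ i * G $ t $ j))"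
      by (simp add: fisher_info_def matrix_matrix_mult_def transpose_def sum_distrib_left sum_distrib_right ac_simps)
    moreover have "\<dots> = (\<Sum>x\<in>UNIV. \<Sum>t\<in>UNIV. ?W $ x $ t * (G $ x $ i * G $ t $ j))"
      by (rule sum.swap)
    ultimately show ?thesis
      by (simp add: Y_mat_def outer_def row_def sum.distrib distrib_left flip: sum_divide_distrib)
  qed
  then show ?thesis by (simp add: vec_eq_iff)
qed

text \<open>The importance-weighted estimator from a single draw. Division by zero makes it the zero
  matrix where \<pi> vanishes.\<close>

definition sample_term :: "real^'k^'x \<Rightarrow> real^'x^'x \<Rightarrow> ('x \<times> 'x) pmf \<Rightarrow> 'x \<times> 'x \<Rightarrow> real^'k^'k" where
  "sample_term G \<Gamma> \<pi> a = (1 / (2 * pmf \<pi> a)) *\<^sub>R Y_mat G \<Gamma> (fst a) (snd a)"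

lemma sampled_fisher_info_eq:
  "sampled_fisher_info G \<Gamma> \<pi> c s = (1 / real c) *\<^sub>R (\<Sum>j=1..c. sample_term G \<Gamma> \<pi> (s j))"
  by (simp add: sampled_fisher_info_def sample_term_def scaleR_sum_right ac_simps)

lemma Y_total_eq_sum: "Y_total G \<Gamma> = (\<Sum>a\<in>UNIV. norm (Y_mat G \<Gamma> (fst a) (snd a)))"
  by (simp add: Y_total_def frobenius_norm_eq_norm sum.cartesian_product case_prod_unfold)

section \<open>Moments and concentration of the estimator under the lower bound on \<pi>\<close>

context
  fixes G :: "real^'k^'x::finite" and \<Gamma> :: "real^'x^'x" and \<pi> :: "('x \<times> 'x) pmf" and \<beta> :: real
  assumes beta: "\<beta> > 0"
    and total: "Y_total G \<Gamma> > 0"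
    and pi: "\<And>x t. pmf \<pi> (x, t) \<ge> \<beta> * pi_tilde G \<Gamma> x t"
begin

text \<open>The lower bound on \<pi> solved for the norm. In particular \<open>Y_mat\<close>
  vanishes wherever \<pi> does, so pairs that are never drawn carry no information.\<close>

lemma norm_Y_mat_le: "norm (Y_mat G \<Gamma> (fst a) (snd a)) \<le> Y_total G \<Gamma> / \<beta> * pmf \<pi> a"
  using pi[of "fst a" "snd a"] beta total
  by (simp add: pi_tilde_def frobenius_norm_eq_norm field_simps)

lemma norm_sample_term_le: "norm (sample_term G \<Gamma> \<pi> a) \<le> Y_total G \<Gamma> / (2 * \<beta>)"
proof (cases "pmf \<pi> a = 0")
  case True
  then show ?thesis using beta total by (simp add: sample_term_def)
next
  case False
  then have "pmf \<pi> a > 0" by (simp add: pmf_pos)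
  then show ?thesis
    using norm_Y_mat_le[of a] beta by (simp add: sample_term_def field_simps)
qed

lemma pmf_sample_term: "pmf \<pi> a *\<^sub>R sample_term G \<Gamma> \<pi> a = (1 / 2) *\<^sub>R Y_mat G \<Gamma> (fst a) (snd a)"
  using norm_Y_mat_le[of a] by (cases "pmf \<pi> a = 0") (simp_all add: sample_term_def)

text \<open>Unbiasedness: the weights cancel the sampling probabilities and leave half the sum of
  all \<open>Y_mat\<close>.\<close>

lemma expectation_sample_term: "measure_pmf.expectation \<pi> (sample_term G \<Gamma> \<pi>) = fisher_info G \<Gamma>"
proof -
  have "measure_pmf.expectation \<pi> (sample_term G \<Gamma> \<pi>) = (\<Sum>a\<in>UNIV. pmf \<pi> a *\<^sub>R sample_term G \<Gamma> \<pi> a)"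
    by (rule integral_measure_pmf) auto
  then show ?thesis
    by (simp only: pmf_sample_term fisher_info_eq_sum_Y_mat)
       (simp add: sum.cartesian_product case_prod_unfold)
qed

text \<open>One factor of the squared norm absorbs the probability and sums to half of
  \<open>Y_total\<close>; the other is bounded uniformly. This yields \<open>1 / \<beta>\<close>,
  where the uniform bound alone would give \<open>1 / \<beta>^2\<close>.\<close>

lemma second_moment_sample_term:
  "measure_pmf.expectation \<pi> (\<lambda>a. (norm (sample_term G \<Gamma> \<pi> a))\<^sup>2) \<le> (Y_total G \<Gamma>)\<^sup>2 / (4 * \<beta>)"
proof -
  have "measure_pmf.expectation \<pi> (\<lambda>a. (norm (sample_term G \<Gamma> \<pi> a))\<^sup>2)
      = (\<Sum>a\<in>UNIV. pmf \<pi> a *\<^sub>R (norm (sample_term G \<Gamma> \<pi> a))\<^sup>2)"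
    by (rule integral_measure_pmf) auto
  also have "\<dots> = (\<Sum>a\<in>UNIV. norm (pmf \<pi> a *\<^sub>R sample_term G \<Gamma> \<pi> a) * norm (sample_term G \<Gamma> \<pi> a))"
    by (simp add: power2_eq_square mult.assoc)
  also have "\<dots> \<le> (\<Sum>a\<in>UNIV. norm (Y_mat G \<Gamma> (fst a) (snd a)) / 2 * (Y_total G \<Gamma> / (2 * \<beta>)))"
    unfolding pmf_sample_term by (intro sum_mono mult_mono norm_sample_term_le) auto
  also have "\<dots> = (Y_total G \<Gamma>)\<^sup>2 / (4 * \<beta>)"
    by (simp add: Y_total_eq_sum power2_eq_square flip: sum_distrib_right sum_divide_distrib)
  finally show ?thesis .
qed

text \<open>Centring at the mean lowers the second moment by the squared norm of the mean.\<close>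

lemma variance_sample_term:
  "measure_pmf.expectation \<pi> (\<lambda>a. (norm (sample_term G \<Gamma> \<pi> a - fisher_info G \<Gamma>))\<^sup>2) \<le> (Y_total G \<Gamma>)\<^sup>2 / (4 * \<beta>)"
proof -
  let ?X = "sample_term G \<Gamma> \<pi>" and ?I = "fisher_info G \<Gamma>"
  have "measure_pmf.expectation \<pi> (\<lambda>a. (norm (?X a - ?I))\<^sup>2)
      = measure_pmf.expectation \<pi> (\<lambda>a. (norm (?X a))\<^sup>2 - 2 * (?I \<bullet> ?X a) + (norm ?I)\<^sup>2)"
    by (intro Bochner_Integration.integral_cong)
       (auto simp: power2_norm_eq_inner inner_diff inner_commute)
  also have "\<dots> = measure_pmf.expectation \<pi> (\<lambda>a. (norm (?X a))\<^sup>2) - 2 * (?I \<bullet> measure_pmf.expectation \<pi> ?X) + (norm ?I)\<^sup>2"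
    by (simp add: integrable_measure_pmf_finite)
  also have "\<dots> \<le> measure_pmf.expectation \<pi> (\<lambda>a. (norm (?X a))\<^sup>2)"
    by (simp add: expectation_sample_term power2_norm_eq_inner)
  finally show ?thesis
    using second_moment_sample_term by linarith
qed

lemma prob_sampled_fisher_info_far:
  assumes delta: "0 < \<delta>" "\<delta> < 1" and eps: "0 < \<epsilon>" and c: "c \<ge> 1"
    and c_large: "real c \<ge> (Y_total G \<Gamma>)\<^sup>2 * ((1 + sqrt (2 * inverse \<beta> * ln (inverse \<delta>)))\<^sup>2 / (\<beta> * \<epsilon>\<^sup>2))"
  shows "measure_pmf.prob (Pi_pmf {1..c} d (\<lambda>_. \<pi>))
     {f. \<epsilon> < norm (sampled_fisher_info G \<Gamma> \<pi> c f - fisher_info G \<Gamma>)} \<le> \<delta>"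
proof -
  let ?P = "Pi_pmf {1..c} d (\<lambda>_. \<pi>)"
  define S where "S = Y_total G \<Gamma>"
  define q where "q = sqrt (2 * inverse \<beta> * ln (inverse \<delta>))"
  define Z where "Z = (\<lambda>a. sample_term G \<Gamma> \<pi> a - fisher_info G \<Gamma>)"
  \<comment> \<open>Chosen so that \<open>sqrt c * S / sqrt \<beta> + t\<close> factors as
    \<open>sqrt c * S * (1 + q) / sqrt \<beta>\<close>, the quantity controlled by the sample
    size.\<close>
  define t where "t = sqrt (real c) * S * q / sqrt \<beta>"
  have S: "S > 0" using total by (simp add: S_def)
  have "ln (inverse \<delta>) > 0" using delta by (simp add: ln_inverse)
  then have q: "q > 0" and q2: "q\<^sup>2 = 2 * inverse \<beta> * ln (inverse \<delta>)"
    using beta by (simp_all add: q_def)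
  have t: "t > 0" using S q beta c by (simp add: t_def)
  have mean: "measure_pmf.expectation \<pi> Z = 0"
    unfolding Z_def by (simp add: integrable_measure_pmf_finite expectation_sample_term)
  \<comment> \<open>The mean cancels in the difference, leaving two terms of norm at most
    \<open>S / (2 * \<beta>)\<close> each.\<close>
  have osc: "norm (Z x - Z y) \<le> S / \<beta>" for x y
    using norm_triangle_ineq4[of "sample_term G \<Gamma> \<pi> x" "sample_term G \<Gamma> \<pi> y"]
      norm_sample_term_le[of x] norm_sample_term_le[of y]
    by (simp add: Z_def S_def[symmetric])
  \<comment> \<open>The square root of the sample-size condition.\<close>
  have "S * (1 + q) \<le> sqrt (real c) * (sqrt \<beta> * \<epsilon>)"
  proof (rule power2_le_imp_le)
    have "(S * (1 + q))\<^sup>2 \<le> real c * (\<beta> * \<epsilon>\<^sup>2)"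
      using c_large beta eps unfolding power_mult_distrib S_def[symmetric] q_def[symmetric]
      using pos_divide_le_eq[of "\<beta> * \<epsilon>\<^sup>2" "S\<^sup>2 * (1 + q)\<^sup>2" "real c"] by simp
    then show "(S * (1 + q))\<^sup>2 \<le> (sqrt (real c) * (sqrt \<beta> * \<epsilon>))\<^sup>2"
      using beta by (simp add: power_mult_distrib)
  qed (use beta eps in simp)
  then have "sqrt (real c) * (S * (1 + q)) / sqrt \<beta>
      \<le> sqrt (real c) * (sqrt (real c) * (sqrt \<beta> * \<epsilon>)) / sqrt \<beta>"
    using beta by (intro divide_right_mono mult_left_mono) auto
  also have "\<dots> = sqrt (real c) * sqrt (real c) * \<epsilon>"
    using beta by simp
  also have "\<dots> = real c * \<epsilon>"
    by simp
  also have "sqrt (real c) * (S * (1 + q)) / sqrt \<beta> = sqrt (real c) * S / sqrt \<beta> + t"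
    by (simp add: t_def distrib_left add_divide_distrib)
  finally have "sqrt (real c) * S / sqrt \<beta> + t \<le> real c * \<epsilon>" .
  \<comment> \<open>The bound on the mean deviation is only half of the right-hand side.\<close>
  moreover have "sqrt (real c * (S\<^sup>2 / (4 * \<beta>))) \<le> sqrt (real c) * S / sqrt \<beta>"
    using S beta by (simp add: real_sqrt_mult real_sqrt_divide field_simps)
  ultimately have thr: "sqrt (real c * (S\<^sup>2 / (4 * \<beta>))) + t \<le> real c * \<epsilon>"
    by linarith
  have dev: "real c * norm (sampled_fisher_info G \<Gamma> \<pi> c f - fisher_info G \<Gamma>) = norm (\<Sum>j=1..c. Z (f j))" for f
  proof -
    have "real c *\<^sub>R (sampled_fisher_info G \<Gamma> \<pi> c f - fisher_info G \<Gamma>) = (\<Sum>j=1..c. Z (f j))"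
      using c by (simp add: sampled_fisher_info_eq Z_def sum_subtractf scaleR_diff_right sum_constant_scaleR
        del: sum_constant)
    from arg_cong[OF this, of norm] show ?thesis by simp
  qed
  have "measure_pmf.prob ?P {f. \<epsilon> < norm (sampled_fisher_info G \<Gamma> \<pi> c f - fisher_info G \<Gamma>)}
      \<le> measure_pmf.prob ?P {f. norm (\<Sum>j=1..c. Z (f j)) \<ge> sqrt (real c * (S\<^sup>2 / (4 * \<beta>))) + t}"
  proof (rule measure_pmf.finite_measure_mono)
    have "sqrt (real c * (S\<^sup>2 / (4 * \<beta>))) + t \<le> norm (\<Sum>j=1..c. Z (f j))"
      if "\<epsilon> < norm (sampled_fisher_info G \<Gamma> \<pi> c f - fisher_info G \<Gamma>)" for f
    proof -
      have "real c * \<epsilon> \<le> norm (\<Sum>j=1..c. Z (f j))"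
        unfolding dev[symmetric] using that by (intro mult_left_mono) auto
      with thr show ?thesis by linarith
    qed
    then show "{f. \<epsilon> < norm (sampled_fisher_info G \<Gamma> \<pi> c f - fisher_info G \<Gamma>)}
        \<subseteq> {f. norm (\<Sum>j=1..c. Z (f j)) \<ge> sqrt (real c * (S\<^sup>2 / (4 * \<beta>))) + t}"
      by blast
  qed simp
  also have "\<dots> \<le> exp (- 2 * t\<^sup>2 / (real c * (S / \<beta>)\<^sup>2))"
    using variance_sample_term c S beta t
    by (intro prob_norm_sum_ge_le mean osc) (auto simp: Z_def S_def)
  \<comment> \<open>Since \<open>q^2 = 2 * ln (1 / \<delta>) / \<beta>\<close>, the exponent is
    \<open>- 4 * ln (1 / \<delta>)\<close>: the tail is at most \<open>\<delta>^4\<close>, hence at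
    most \<delta>.\<close>
  also have "2 * t\<^sup>2 / (real c * (S / \<beta>)\<^sup>2) = 2 * \<beta> * q\<^sup>2"
    using S beta c by (simp add: t_def power_mult_distrib power_divide field_simps power2_eq_square)
  then have "exp (- 2 * t\<^sup>2 / (real c * (S / \<beta>)\<^sup>2)) = exp (- (4 * ln (inverse \<delta>)))"
    using beta by (simp add: q2)
  also have "\<dots> \<le> exp (- ln (inverse \<delta>))"
    using \<open>ln (inverse \<delta>) > 0\<close> by simp
  also have "\<dots> = \<delta>"
    using delta by (simp add: ln_inverse)
  finally show ?thesis .
qed

end

theorem theorem3:
  fixes F :: "'x::finite \<Rightarrow> real^'k \<Rightarrow> real"
    and p :: "real^'k"
    and \<Gamma> :: "real^'x^'x"
    and G :: "real^'k^'x"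
    and \<pi> :: "('x \<times> 'x) pmf"
    and M :: "'w measure"
    and s :: "nat \<Rightarrow> 'w \<Rightarrow> 'x \<times> 'x"
    and c :: nat
    and \<beta> \<delta> \<epsilon> :: real
  assumes diff: "\<And>x. F x differentiable (at p)"
    and Gamma: "sym_pos_def \<Gamma>"
    and G: "G = sensitivity F p"
    and full_rank: "rank (fisher_info G \<Gamma>) = CARD('k)"
    and beta: "0 < \<beta>" "\<beta> \<le> 1"
    and pi: "\<And>x t. pmf \<pi> (x, t) \<ge> \<beta> * pi_tilde G \<Gamma> x t"
    and prob: "prob_space M"
    and indep: "prob_space.indep_vars M (\<lambda>_. count_space UNIV) s {1..c}"
    and distr: "\<And>j. j \<in> {1..c} \<Longrightarrow> distr M (count_space UNIV) (s j) = measure_pmf \<pi>"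
    and delta: "0 < \<delta>" "\<delta> < 1"
    and eps: "0 < \<epsilon>" "\<epsilon> < lambda_min (fisher_info G \<Gamma>)"
    and c_pos: "c \<ge> 1"
    and c_large: "real c \<ge> (Y_total G \<Gamma>)\<^sup>2 * ((1 + sqrt (2 * inverse \<beta> * ln (inverse \<delta>)))\<^sup>2 / (\<beta> * \<epsilon>\<^sup>2))"
  shows "\<P>(\<omega> in M.
      (let I = fisher_info G \<Gamma>;
           Ic = sampled_fisher_info G \<Gamma> \<pi> c (\<lambda>j. s j \<omega>)
       in lambda_min Ic \<ge> lambda_min I - \<epsilon> \<and> lambda_min I - \<epsilon> > 0 \<and>
          inv_cond Ic \<ge> inv_cond I * ((lambda_min I - \<epsilon>) / (lambda_min I + \<epsilon>))))
      \<ge> 1 - \<delta>"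
proof -
  interpret prob_space M by (rule prob)
  let ?I = "fisher_info G \<Gamma>" and ?P = "Pi_pmf {1..c} undefined (\<lambda>_. \<pi>)"
  let ?near = "\<lambda>f. norm (sampled_fisher_info G \<Gamma> \<pi> c f - ?I) \<le> \<epsilon>"
  define Q where "Q = (\<lambda>f. let I = ?I; Ic = sampled_fisher_info G \<Gamma> \<pi> c f
       in lambda_min Ic \<ge> lambda_min I - \<epsilon> \<and> lambda_min I - \<epsilon> > 0 \<and>
          inv_cond Ic \<ge> inv_cond I * ((lambda_min I - \<epsilon>) / (lambda_min I + \<epsilon>)))"
  note symY = symmetric_matrix_Y_mat[OF symmetric_matrix_inv[OF Gamma]]
  have symI: "symmetric_matrix ?I"
    unfolding fisher_info_eq_sum_Y_mat by (intro symmetric_matrix_sum symmetric_matrix_scaleR symY)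
  have symIc: "symmetric_matrix (sampled_fisher_info G \<Gamma> \<pi> c f)" for f
    unfolding sampled_fisher_info_def by (intro symmetric_matrix_sum symmetric_matrix_scaleR symY)
  \<comment> \<open>If all \<open>Y_mat\<close> vanished, the Fisher information would be the zero
    matrix, whose only eigenvalue is 0, although \<epsilon> lies strictly between 0 and the smallest
    eigenvalue.\<close>
  have "Y_total G \<Gamma> \<noteq> 0"
  proof
    assume "Y_total G \<Gamma> = 0"
    then have "Y_mat G \<Gamma> (fst a) (snd a) = 0" for a
      by (simp add: Y_total_eq_sum sum_nonneg_eq_0_iff)
    from this[of "(_, _)"] have "?I = 0"
      by (simp add: fisher_info_eq_sum_Y_mat)
    with lambda_min_in[OF symI] have "lambda_min ?I = 0"
      by (auto simp: eigenvalues_def)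
    with eps show False by simp
  qed
  moreover have "Y_total G \<Gamma> \<ge> 0"
    by (simp add: Y_total_eq_sum sum_nonneg)
  ultimately have total: "Y_total G \<Gamma> > 0" by simp
  \<comment> \<open>The deterministic half: whenever the sampled matrix is within \<epsilon> of the
    Fisher information, all the claimed spectral bounds hold.\<close>
  have near_imp: "Q f" if "?near f" for f
    using lambda_min_perturbation[OF symI symIc, of f] inv_cond_perturbation[OF symI symIc that] that eps
    by (simp add: Q_def Let_def)
  have "1 - \<delta> \<le> 1 - measure_pmf.prob ?P {f. \<epsilon> < norm (sampled_fisher_info G \<Gamma> \<pi> c f - ?I)}"
    using prob_sampled_fisher_info_far[OF beta(1) total pi delta eps(1) c_pos c_large] by simp
  also have "\<dots> = measure_pmf.prob ?P (UNIV - {f. \<epsilon> < norm (sampled_fisher_info G \<Gamma> \<pi> c f - ?I)})"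
    using measure_pmf.prob_compl[of "{f. \<epsilon> < norm (sampled_fisher_info G \<Gamma> \<pi> c f - ?I)}" ?P] by simp
  also have "\<dots> \<le> measure_pmf.prob ?P {f. Q f}"
    by (intro measure_pmf.finite_measure_mono) (auto intro!: near_imp)
  \<comment> \<open>The sampled matrix reads only the samples \<open>1\<close> to \<open>c\<close>,
    so the event can be carried back from the product distribution to \<open>M\<close>.\<close>
  also have "\<dots> = prob {\<omega> \<in> space M. Q (\<lambda>j. s j \<omega>)}"
  proof (rule prob_iid_eq_Pi_pmf[symmetric])
    show "Q f = Q g" if "\<And>i. i \<in> {1..c} \<Longrightarrow> f i = g i" for f g
    proof -
      have "sampled_fisher_info G \<Gamma> \<pi> c f = sampled_fisher_info G \<Gamma> \<pi> c g"
        unfolding sampled_fisher_info_def using that by (intro sum.cong) auto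
      then show ?thesis by (simp add: Q_def)
    qed
  qed (use c_pos indep distr in auto)
  finally show ?thesis
    unfolding Q_def .
qed

end
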